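(* Let $G=(V,E)$ be an arbitrary finite network in which every node has at least one neighbor, let $f$ be a Type III combat-power function, and consider the Type III dynamics $$\frac{d}{dt}B_v(t)=f\Big(\frac{1}{\deg(v)}\sum_{u\in N_v}B_u(t)\Big)-B_v(t),\quad v\in V,$$ with state space $[0,1]^V$. (i) If $B_v(0)>0$ for all $v\in V$, then $\lim_{t\to\infty}B_v(t)=1$ for all $v\in V$. (ii) The equilibrium $[1,\dots,1]$ is asymptotically stable with exponential convergence. (iii) The equilibrium $[0,\dots,0]$ is unstable.
   Context: $G=(V,E)$ is a finite graph (undirected or directed) without self-loops, $N_v=\{u\in V:(u,v)\in E\}$ is the set of (in-)neighbors of $v$, and $\deg(v)=|N_v|$. A Type III combat-power function is a function $f:[0,1]\to[0,1]$ that is concave, continuous and increasing on $[0,1]$, with $f(0)=0$, $f(1)=1$ and $f(x)>x$ for $x\in(0,1)$. $B_v(t)\in[0,1]$ represents the probability that node $v$ is secure at time $t$. An equilibrium $B^*$ is (asymptotically) stable if there is a neighborhood of $B^*$ in $[0,1]^V$ such that every trajectory $B(t)$ initially located in the neighborhood converges to $B^*$; it is stable with exponential convergence if moreover for each trajectory $B(t)$ starting in the neighborhood there exist constants $\varrho>0$ and $M>0$ such that $\|B(t)-B^*\|\le Me^{-\varrho t}$ for all $t\ge0$. Unstable means not stable. *)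

theory Defs
  imports "HOL-Analysis.Analysis"
begin

text \<open>
  A network on the vertex type \<open>'v\<close> is an irreflexive edge relation \<open>E\<close>, with
  \<open>(u, v) \<in> E\<close> meaning that \<open>u\<close> is an in-neighbor of \<open>v\<close>.  Undirected networks are those
  with symmetric \<open>E\<close>.
\<close>

definition nbrs :: "('v \<times> 'v) set \<Rightarrow> 'v \<Rightarrow> 'v set" where
  "nbrs E v = {u. (u, v) \<in> E}"

definition deg :: "('v \<times> 'v) set \<Rightarrow> 'v \<Rightarrow> nat" where
  "deg E v = card (nbrs E v)"

text \<open>
  Only the values of \<open>f\<close> on \<open>[0,1]\<close> matter.  ``Increasing'' is read in the weak sense, so
  strictly increasing functions are included.
\<close>

definition type_III :: "(real \<Rightarrow> real) \<Rightarrow> bool" where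
  "type_III f \<longleftrightarrow>
     f ` {0..1} \<subseteq> {0..1} \<and>
     concave_on {0..1} f \<and> continuous_on {0..1} f \<and> mono_on {0..1} f \<and>
     f 0 = 0 \<and> f 1 = 1 \<and> (\<forall>x\<in>{0<..<1}. f x > x)"

definition state_space :: "(real ^ 'v) set" where
  "state_space = {b. \<forall>v. b $ v \<in> {0..1}}"

definition type_III_field ::
    "('v::finite \<times> 'v) set \<Rightarrow> (real \<Rightarrow> real) \<Rightarrow> real ^ 'v \<Rightarrow> real ^ 'v" where
  "type_III_field E f b =
     (\<chi> v. f (1 / real (deg E v) * (\<Sum>u\<in>nbrs E v. b $ u)) - b $ v)"

text \<open>
  In the following, \<open>S\<close> is the state space and \<open>F\<close> the vector field of an autonomous
  system.  Trajectories are global forward solutions staying in \<open>S\<close>; at time \<open>0\<close> the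
  derivative is one-sided.
\<close>

definition trajectory :: "'a::real_normed_vector set \<Rightarrow> ('a \<Rightarrow> 'a) \<Rightarrow> (real \<Rightarrow> 'a) \<Rightarrow> bool" where
  "trajectory S F B \<longleftrightarrow>
     (\<forall>t\<ge>0. B t \<in> S \<and> (B has_vector_derivative F (B t)) (at t within {0..}))"

definition equilibrium :: "'a::real_normed_vector set \<Rightarrow> ('a \<Rightarrow> 'a) \<Rightarrow> 'a \<Rightarrow> bool" where
  "equilibrium S F b \<longleftrightarrow> b \<in> S \<and> F b = 0"

definition stable :: "'a::real_normed_vector set \<Rightarrow> ('a \<Rightarrow> 'a) \<Rightarrow> 'a \<Rightarrow> bool" where
  "stable S F b \<longleftrightarrow>
     (\<exists>U. openin (top_of_set S) U \<and> b \<in> U \<and>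
        (\<forall>B. trajectory S F B \<and> B 0 \<in> U \<longrightarrow> (B \<longlongrightarrow> b) at_top))"

text \<open>The constants \<open>\<rho>\<close> and \<open>M\<close> may depend on the trajectory.\<close>

definition exp_stable :: "'a::real_normed_vector set \<Rightarrow> ('a \<Rightarrow> 'a) \<Rightarrow> 'a \<Rightarrow> bool" where
  "exp_stable S F b \<longleftrightarrow>
     (\<exists>U. openin (top_of_set S) U \<and> b \<in> U \<and>
        (\<forall>B. trajectory S F B \<and> B 0 \<in> U \<longrightarrow>
           (B \<longlongrightarrow> b) at_top \<and>
           (\<exists>\<rho>>0. \<exists>M>0. \<forall>t\<ge>0. norm (B t - b) \<le> M * exp (- \<rho> * t))))"

definition unstable :: "'a::real_normed_vector set \<Rightarrow> ('a \<Rightarrow> 'a) \<Rightarrow> 'a \<Rightarrow> bool" where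
  "unstable S F b \<longleftrightarrow> \<not> stable S F b"

end

theory Submission
  imports Defs
begin

text \<open>
  Everything positive is attracted to \<open>1\<close> by a comparison argument.  If all coordinates start
  above \<open>m \<in> (0,1)\<close>, then concavity bounds \<open>f\<close> on \<open>[m,1]\<close> below by the chord
  \<open>x \<mapsto> 1 - c (1 - x)\<close>, where \<open>c < 1\<close> because \<open>f m > m\<close>.  For \<open>0 < \<rho> < 1 - c\<close> the
  function \<open>\<phi> t = 1 - (1 - m) exp (- \<rho> t)\<close> is a strict subsolution, so no coordinate can
  be the first one to reach it.  This yields (i) and (ii) at once.

  For (iii), separation of variables produces a synchronous trajectory (all coordinates equal)
  starting at any prescribed level in \<open>(0,1)\<close>; it exists for all times because
  \<open>f x - x \<le> 1 - x\<close> makes \<open>\<integral> dx / (f x - x)\<close> diverge at \<open>1\<close>.  By (i) it leaves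
  every small neighborhood of the origin.  Note that \<open>f\<close> need not be Lipschitz at \<open>0\<close>, so
  the general existence theorem would not apply directly.
\<close>

section \<open>First-contact principle and a scalar differential equation\<close>

text \<open>At the earliest time some \<open>h w\<close> vanishes, every \<open>h u\<close> is still
  nonnegative; a positive derivative of \<open>h w\<close> there would make it negative just before.
  So \<open>deriv\<close> is demanded only at such contacts.\<close>

lemma positive_by_first_zero:
  fixes h :: "'v::finite \<Rightarrow> real \<Rightarrow> real"
  assumes cont: "\<And>v. continuous_on {0..} (h v)"
    and init: "\<And>v. h v 0 > 0"
    and deriv: "\<And>t v. t > 0 \<Longrightarrow> (\<And>u. h u t \<ge> 0) \<Longrightarrow> h v t = 0 \<Longrightarrow>
                  \<exists>D>0. (h v has_real_derivative D) (at t within {0..})"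
    and "t \<ge> 0"
  shows "h v t > 0"
proof (rule ccontr)
  assume neg: "\<not> h v t > 0"
  \<comment> \<open>A finite union of closed sets is closed, so the first contact time
    \<open>Inf S\<close> is attained.\<close>
  define S where "S = (\<Union>v. {s \<in> {0..t}. h v s \<le> 0})"
  have "closed {s \<in> {0..t}. h v s \<le> 0}" for v
    by (rule continuous_on_closed_Collect_le[OF continuous_on_subset[OF cont]]) auto
  then have "closed S"
    unfolding S_def by auto
  moreover have "t \<in> S"
    using neg \<open>t \<ge> 0\<close> by (auto simp: S_def not_less)
  moreover have bdd: "bdd_below S"
    by (rule bdd_belowI[of _ 0]) (auto simp: S_def)
  ultimately have inS: "Inf S \<in> S"
    by (intro closed_contains_Inf) auto
  define t0 where "t0 = Inf S"
  obtain w where w: "h w t0 \<le> 0" and t0: "0 \<le> t0" "t0 \<le> t"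
    using inS by (auto simp: S_def t0_def)
  have "t0 > 0"
    using w init[of w] t0 by (cases "t0 = 0") auto
  have before: "h u s > 0" if "0 \<le> s" "s < t0" for u s
  proof (rule ccontr)
    assume "\<not> h u s > 0"
    then have "s \<in> S"
      using that t0 by (auto simp: S_def not_less)
    then show False
      using cInf_lower[OF _ bdd] that by (force simp: t0_def)
  qed
  have nonneg: "h u t0 \<ge> 0" for u
  proof (rule tendsto_lowerbound)
    show "(h u \<longlongrightarrow> h u t0) (at t0 within {0..<t0})"
      by (rule tendsto_within_subset[of "h u" _ t0 "{0..}"])
        (use cont[of u] t0 in \<open>auto simp: continuous_on_def\<close>)
    show "\<forall>\<^sub>F s in at t0 within {0..<t0}. 0 \<le> h u s"
      by (auto simp: eventually_at_filter intro!: always_eventually less_imp_le before)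
    show "at t0 within {0..<t0} \<noteq> bot"
      using \<open>t0 > 0\<close> by (simp add: trivial_limit_within islimpt_in_closure)
  qed
  have zero: "h w t0 = 0"
    using nonneg[of w] w by simp
  obtain D where "D > 0" "(h w has_real_derivative D) (at t0 within {0..})"
    using deriv[OF \<open>t0 > 0\<close> nonneg zero] by blast
  from has_real_derivative_pos_inc_left[OF this(2,1)] obtain d where
    d: "d > 0" "\<And>e. 0 < e \<Longrightarrow> t0 - e \<in> {0..} \<Longrightarrow> e < d \<Longrightarrow> h w (t0 - e) < h w t0"
    by blast
  \<comment> \<open>The cap by \<open>t0\<close> keeps \<open>t0 - e\<close> in the time domain
    \<open>{0..}\<close>.\<close>
  define e where "e = min (d / 2) t0"
  have "h w (t0 - e) < 0"
    using d \<open>t0 > 0\<close> zero by (auto simp: e_def min_def)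
  moreover have "h w (t0 - e) > 0"
    using d \<open>t0 > 0\<close> by (intro before) (auto simp: e_def)
  ultimately show False
    by simp
qed

text \<open>The solution is the inverse of a primitive \<open>G\<close> of \<open>1 / g\<close>,
  which measures travel time; continuity and positivity of \<open>g\<close> suffice for this. The
  bound \<open>g x \<le> 1 - x\<close> prevents arrival at 1 in finite time.\<close>

lemma global_scalar_solution:
  fixes g :: "real \<Rightarrow> real"
  assumes cont: "continuous_on {0<..<1} g"
    and pos: "\<And>x. x \<in> {0<..<1} \<Longrightarrow> g x > 0"
    and le: "\<And>x. x \<in> {0<..<1} \<Longrightarrow> g x \<le> 1 - x"
    and a: "0 < a" "a < 1"
  obtains x where "x 0 = a"
    "\<forall>t\<ge>0. x t \<in> {0<..<1}"
    "\<forall>t\<ge>0. (x has_real_derivative g (x t)) (at t)"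
proof -
  \<comment> \<open>Basing \<open>G\<close> strictly below \<open>a\<close> makes \<open>a\<close>
    an interior point, so the solution has a two-sided derivative at time 0; \<open>b > 0\<close>
    avoids the possible singularity of \<open>1 / g\<close> at 0.\<close>
  define b where "b = a / 2"
  have b: "0 < b" "b < a"
    using a by (auto simp: b_def)
  define G where "G y = integral {b..y} (\<lambda>s. 1 / g s)" for y
  have G: "(G has_real_derivative 1 / g y) (at y)" if "b < y" "y < 1" for y
  proof -
    define c where "c = (1 + y) / 2"
    have c: "y < c" "c < 1"
      using that by (auto simp: c_def)
    have "(G has_real_derivative 1 / g y) (at y within {b..c})"
      unfolding G_def
    proof (rule integral_has_real_derivative)
      show "continuous_on {b..c} (\<lambda>s. 1 / g s)"
        using b c pos
        by (intro continuous_intros continuous_on_subset[OF cont]) (auto simp: less_le)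
    qed (use that c in auto)
    then show ?thesis
      using at_within_interior[of y "{b..c}"] that c by simp
  qed
  have contG: "continuous_on {b<..<1} G"
    by (rule DERIV_continuous_on[OF has_field_derivative_at_within[OF G]]) auto
  have mono: "G y < G z" if "b < y" "y < z" "z < 1" for y z
  proof (rule DERIV_pos_imp_increasing[OF that(2)])
    fix u assume "y \<le> u" "u \<le> z"
    then have "b < u" "u < 1"
      using that by auto
    then show "\<exists>D. (G has_real_derivative D) (at u) \<and> 0 < D"
      using G[of u] pos[of u] b by (intro exI[of _ "1 / g u"]) auto
  qed
  then have inj: "inj_on G {b<..<1}"
    by (intro linorder_inj_onI) force+
  define x where "x t = inv_into {b<..<1} G (G a + t)" for t
  have x_eq: "x (G z - G a) = z" if "b < z" "z < 1" for z
    unfolding x_def using inv_into_f_f[OF inj, of z] that by simp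
  have surj: "\<exists>z. b < z \<and> z < 1 \<and> G z = G a + t" if "t \<ge> 0" for t
  proof -
    \<comment> \<open>This is the time-\<open>t\<close> value of the solution of
      \<open>x' = 1 - x\<close> from \<open>a\<close>. Since \<open>g\<close> is no faster, the
      travel time \<open>G y - G a\<close> is at least \<open>t\<close>; the monotonicity of
      \<open>G y + ln (1 - y)\<close> makes this precise, and the intermediate value theorem then
      gives \<open>z\<close>.\<close>
    define y where "y = 1 - (1 - a) * exp (- t)"
    have "0 < (1 - a) * exp (- t)" "(1 - a) * exp (- t) \<le> 1 - a"
      using a that by (auto intro: mult_left_le)
    then have y: "a \<le> y" "y < 1"
      unfolding y_def by linarith+
    have "G a + ln (1 - a) \<le> G y + ln (1 - y)"
    proof (rule DERIV_nonneg_imp_nondecreasing[OF y(1)])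
      fix u assume "a \<le> u" "u \<le> y"
      then have u: "b < u" "u \<in> {0<..<1}"
        using a b y by auto
      have "((\<lambda>y. G y + ln (1 - y)) has_real_derivative 1 / g u - 1 / (1 - u)) (at u)"
        using u by (auto intro!: derivative_eq_intros G)
      moreover have "1 / (1 - u) \<le> 1 / g u"
        using pos[OF u(2)] le[OF u(2)] by (intro divide_left_mono) auto
      ultimately show
        "\<exists>D. ((\<lambda>y. G y + ln (1 - y)) has_real_derivative D) (at u) \<and> 0 \<le> D"
        by fastforce
    qed
    moreover have "ln (1 - y) = ln (1 - a) - t"
      using a by (simp add: y_def ln_mult)
    ultimately have "G a + t \<le> G y"
      by simp
    moreover have "continuous_on {a..y} G"
      by (rule continuous_on_subset[OF contG]) (use b y in auto)
    ultimately obtain z where "a \<le> z" "z \<le> y" "G z = G a + t"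
      using IVT'[of G a "G a + t" y] y \<open>t \<ge> 0\<close> by auto
    then show ?thesis
      using b y by (intro exI[of _ z]) auto
  qed
  have "x 0 = a"
    using x_eq[of a] a b by simp
  moreover have "x t \<in> {0<..<1} \<and> (x has_real_derivative g (x t)) (at t)" if "t \<ge> 0" for t
  proof
    from that obtain z where z: "b < z" "z < 1" "G z - G a = t"
      using surj by (auto simp: algebra_simps)
    then have xt: "x t = z"
      using x_eq by blast
    then show "x t \<in> {0<..<1}"
      using z b by auto
    have "g z > 0"
      using z b by (intro pos) auto
    have "((\<lambda>y. G y - G a) has_derivative (*) (1 / g z)) (at z)"
      using G[OF z(1,2)] unfolding has_field_derivative_def[symmetric]
      by (auto intro!: derivative_eq_intros)
    then have "(x has_derivative (*) (g z)) (at (G z - G a))"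
      by (rule has_derivative_inverse_strong[where S = "{b<..<1}", rotated 4])
        (use z \<open>g z > 0\<close> x_eq in \<open>auto intro!: continuous_intros contG\<close>)
    then show "(x has_real_derivative g (x t)) (at t)"
      by (simp add: has_field_derivative_def z xt)
  qed
  ultimately show thesis
    using that by blast
qed

section \<open>Chord bound and neighborhood averages\<close>

text \<open>The left side is the chord of \<open>f\<close> from \<open>m\<close> to 1, written
  around the fixed point 1: the deficit \<open>1 - f x\<close> is at most a constant multiple of
  \<open>1 - x\<close>.\<close>

lemma type_III_above_chord:
  assumes f: "type_III f" and x: "m \<le> x" "x \<le> 1" and m: "0 < m" "m < 1"
  shows "1 - (1 - f m) / (1 - m) * (1 - x) \<le> f x"
proof -
  define s where "s = (x - m) / (1 - m)"
  have s: "0 \<le> s" "s \<le> 1"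
    using x m by (auto simp: s_def divide_simps)
  have "1 - s = (1 - x) / (1 - m)"
    using m by (simp add: s_def field_simps)
  have "(1 - s) *\<^sub>R m + s *\<^sub>R 1 = m + s * (1 - m)"
    by (simp add: algebra_simps)
  also have "\<dots> = x"
    using m by (simp add: s_def)
  finally have "(1 - s) * f m + s * f 1 \<le> f x"
    using f s m concave_onD[of "{0..1}" f s m 1] by (auto simp: type_III_def)
  moreover have "f 1 = 1"
    using f by (simp add: type_III_def)
  moreover have "(1 - s) * f m + s = 1 - (1 - f m) * (1 - s)"
    by (simp add: algebra_simps)
  ultimately show ?thesis
    using \<open>1 - s = _\<close> by simp
qed

definition nbr_mean :: "('v::finite \<times> 'v) set \<Rightarrow> real ^ 'v \<Rightarrow> 'v \<Rightarrow> real" where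
  "nbr_mean E b v = 1 / real (deg E v) * (\<Sum>u\<in>nbrs E v. b $ u)"

lemma type_III_field_nth: "type_III_field E f b $ v = f (nbr_mean E b v) - b $ v"
  by (simp add: type_III_field_def nbr_mean_def)

lemma deg_pos: "nbrs E v \<noteq> {} \<Longrightarrow> deg E v > 0" for v :: "'v::finite"
  by (simp add: deg_def card_gt_0_iff)

lemma nbr_mean_ge:
  assumes "nbrs E v \<noteq> {}" and "\<And>u. m \<le> b $ u"
  shows "m \<le> nbr_mean E b v"
  using deg_pos[OF assms(1)] sum_bounded_below[of "nbrs E v" m "\<lambda>u. b $ u"] assms(2)
  by (simp add: nbr_mean_def deg_def field_simps)

lemma nbr_mean_le:
  assumes "nbrs E v \<noteq> {}" and "\<And>u. b $ u \<le> m"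
  shows "nbr_mean E b v \<le> m"
  using deg_pos[OF assms(1)] sum_bounded_above[of "nbrs E v" "\<lambda>u. b $ u" m] assms(2)
  by (simp add: nbr_mean_def deg_def field_simps)

text \<open>Averaging fixes constant vectors, so the diagonal carries the scalar equation
  \<open>x' = f x - x\<close>. This serves both the equilibria and the synchronous
  trajectories.\<close>

lemma type_III_field_diagonal:
  assumes "\<And>v. nbrs E v \<noteq> {}"
  shows "type_III_field E f (\<chi> v. x) = (\<chi> v. f x - x)"
proof -
  have "nbr_mean E (\<chi> v. x) v = x" for v
    using nbr_mean_ge[OF assms, of x "\<chi> v. x"] nbr_mean_le[OF assms, of "\<chi> v. x" x]
    by (simp add: antisym)
  then show ?thesis
    by (simp add: vec_eq_iff type_III_field_nth)
qed

section \<open>Exponential convergence to the all-ones state\<close>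

text \<open>No connectivity enters: if all coordinates lie above a level, so does every neighborhood
  mean. The rate \<open>\<rho>\<close> is chosen from the smallest initial coordinate.\<close>

lemma trajectory_exp_bound:
  fixes E :: "('v::finite \<times> 'v) set"
  assumes nbrs: "\<And>v. nbrs E v \<noteq> {}" and f: "type_III f"
    and B: "trajectory state_space (type_III_field E f) B"
    and init: "\<And>v. B 0 $ v > 0"
  obtains \<rho> where "\<rho> > 0" "\<And>t v. t \<ge> 0 \<Longrightarrow> 1 - B t $ v \<le> exp (- \<rho> * t)"
proof -
  have B01: "0 \<le> B t $ v" "B t $ v \<le> 1" if "t \<ge> 0" for t v
    using B that by (auto simp: trajectory_def state_space_def)
  have dB: "((\<lambda>t. B t $ v) has_real_derivative f (nbr_mean E (B t) v) - B t $ v)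
              (at t within {0..})" if "t \<ge> 0" for t v
    using B that bounded_linear.has_vector_derivative[OF bounded_linear_vec_nth]
    by (fastforce simp: trajectory_def has_real_derivative_iff_has_vector_derivative
        simp flip: type_III_field_nth)
  \<comment> \<open>Halving gives strict room below every initial value and ensures
    \<open>m < 1\<close> even when the trajectory starts at all ones.\<close>
  define m where "m = Min (range (\<lambda>v. B 0 $ v)) / 2"
  have "Min (range (\<lambda>v. B 0 $ v)) > 0"
    using init by (subst Min_gr_iff) auto
  moreover have min_le: "Min (range (\<lambda>v. B 0 $ v)) \<le> B 0 $ v" for v
    by (rule Min_le) auto
  ultimately have m: "0 < m" "m < B 0 $ v" for v
    unfolding m_def by (simp, smt (verit) min_le[of v] field_sum_of_halves)
  have m1: "m < 1"
    using m(2) B01(2)[of 0] by (metis order_refl less_le_trans)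
  define c where "c = (1 - f m) / (1 - m)"
  have "f m > m"
    using f m m1 by (simp add: type_III_def)
  then have "c < 1"
    using m1 by (simp add: c_def)
  \<comment> \<open>Any rate strictly between 0 and \<open>1 - c\<close> would do; strictness is
    what yields a positive derivative at a contact.\<close>
  define \<rho> where "\<rho> = (1 - c) / 2"
  have \<rho>: "\<rho> > 0" "\<rho> < 1 - c"
    using \<open>c < 1\<close> by (auto simp: \<rho>_def)
  define \<phi> where "\<phi> t = 1 - (1 - m) * exp (- \<rho> * t)" for t
  have \<phi>: "m \<le> \<phi> t" "\<phi> t < 1" if "t \<ge> 0" for t
  proof -
    have "0 < (1 - m) * exp (- \<rho> * t)" "(1 - m) * exp (- \<rho> * t) \<le> 1 - m"
      using that m1 \<rho> by (auto intro: mult_left_le)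
    then show "m \<le> \<phi> t" "\<phi> t < 1"
      unfolding \<phi>_def by linarith+
  qed
  have d\<phi>: "(\<phi> has_real_derivative \<rho> * (1 - \<phi> t)) (at t within {0..})" for t
    unfolding \<phi>_def by (auto intro!: derivative_eq_intros)
  have above: "B t $ v - \<phi> t > 0" if "t \<ge> 0" for t v
  proof (rule positive_by_first_zero[of "\<lambda>v t. B t $ v - \<phi> t", OF _ _ _ that])
    show "continuous_on {0..} (\<lambda>t. B t $ v - \<phi> t)" for v
      by (rule DERIV_continuous_on[OF DERIV_diff[OF dB d\<phi>]]) simp
    show "B 0 $ v - \<phi> 0 > 0" for v
      using m by (simp add: \<phi>_def)
  next
    fix t v
    assume "t > 0" and ge: "\<And>u. B t $ u - \<phi> t \<ge> 0" and eq: "B t $ v - \<phi> t = 0"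
    let ?a = "nbr_mean E (B t) v"
    have a: "\<phi> t \<le> ?a" "?a \<le> 1"
      using ge B01 \<open>t > 0\<close> by (auto intro!: nbr_mean_ge nbr_mean_le nbrs)
    \<comment> \<open>The left side is the speed of \<open>\<phi>\<close>. At a contact, the chord
      bound and monotonicity of \<open>f\<close> give the coordinate speed at least
      \<open>(1 - c) * (1 - \<phi> t)\<close>, which is larger because
      \<open>\<phi> t < 1\<close>.\<close>
    have "\<rho> * (1 - \<phi> t) < (1 - c) * (1 - \<phi> t)"
      using \<rho> \<phi>[of t] \<open>t > 0\<close> by simp
    also have "\<dots> = 1 - c * (1 - \<phi> t) - B t $ v"
      using eq by (simp add: algebra_simps)
    also have "1 - c * (1 - \<phi> t) \<le> f (\<phi> t)"
      unfolding c_def using \<phi>[of t] \<open>t > 0\<close> m m1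
      by (intro type_III_above_chord[OF f]) auto
    also have "f (\<phi> t) \<le> f ?a"
      using f \<phi>[of t] \<open>t > 0\<close> m a by (auto simp: type_III_def intro!: mono_onD[of "{0..1}" f])
    finally have "0 < f ?a - B t $ v - \<rho> * (1 - \<phi> t)"
      by simp
    then show "\<exists>D>0. ((\<lambda>t. B t $ v - \<phi> t) has_real_derivative D) (at t within {0..})"
      using DERIV_diff[OF dB d\<phi>] \<open>t > 0\<close> by (meson less_imp_le)
  qed
  show thesis
  proof
    fix t v assume "(t::real) \<ge> 0"
    have "1 - B t $ v \<le> (1 - m) * exp (- \<rho> * t)"
      using above[OF \<open>t \<ge> 0\<close>, of v] by (simp add: \<phi>_def)
    also have "\<dots> \<le> 1 * exp (- \<rho> * t)"
      using m by (intro mult_right_mono) auto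
    finally show "1 - B t $ v \<le> exp (- \<rho> * t)"
      by simp
  qed (rule \<rho>)
qed

lemma trajectory_exp_convergence:
  fixes E :: "('v::finite \<times> 'v) set"
  assumes nbrs: "\<And>v. nbrs E v \<noteq> {}" and f: "type_III f"
    and B: "trajectory state_space (type_III_field E f) B"
    and init: "\<And>v. B 0 $ v > 0"
  obtains \<rho> M where "\<rho> > 0" "M > 0"
    "\<And>t. t \<ge> 0 \<Longrightarrow> norm (B t - (\<chi> v. 1)) \<le> M * exp (- \<rho> * t)"
proof -
  obtain \<rho> where \<rho>: "\<rho> > 0" "\<And>t v. t \<ge> 0 \<Longrightarrow> 1 - B t $ v \<le> exp (- \<rho> * t)"
    using trajectory_exp_bound[OF nbrs f B init] by metis
  show thesis
  proof
    fix t :: real assume "t \<ge> 0"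
    have "B t $ v \<le> 1" for v
      using B \<open>t \<ge> 0\<close> by (auto simp: trajectory_def state_space_def)
    have "norm (B t - (\<chi> v. 1)) \<le> (\<Sum>v\<in>UNIV. \<bar>(B t - (\<chi> v. 1)) $ v\<bar>)"
      by (rule norm_le_l1_cart)
    also have "\<dots> = (\<Sum>v\<in>UNIV. 1 - B t $ v)"
      using \<open>\<And>v. B t $ v \<le> 1\<close> by (intro sum.cong) (auto simp: abs_if not_less antisym)
    also have "\<dots> \<le> real CARD('v) * exp (- \<rho> * t)"
      using \<rho>(2)[OF \<open>t \<ge> 0\<close>] by (intro sum_bounded_above) auto
    finally show "norm (B t - (\<chi> v. 1)) \<le> real CARD('v) * exp (- \<rho> * t)" .
  qed (use \<rho> in auto)
qed

lemma trajectory_tendsto_one: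
  fixes E :: "('v::finite \<times> 'v) set"
  assumes "\<And>v. nbrs E v \<noteq> {}" and "type_III f"
    and "trajectory state_space (type_III_field E f) B"
    and "\<And>v. B 0 $ v > 0"
  shows "(B \<longlongrightarrow> (\<chi> v. 1)) at_top"
proof -
  obtain \<rho> M where \<rho>: "\<rho> > 0"
    and M: "\<And>t. t \<ge> 0 \<Longrightarrow> norm (B t - (\<chi> v. 1)) \<le> M * exp (- \<rho> * t)"
    using trajectory_exp_convergence[OF assms] by metis
  have "filterlim (\<lambda>t. - \<rho> * t) at_bot at_top"
    using \<rho> by (intro filterlim_tendsto_neg_mult_at_bot[OF tendsto_const _ filterlim_ident]) auto
  then have "((\<lambda>t. exp (- \<rho> * t)) \<longlongrightarrow> 0) at_top"
    by (rule filterlim_compose[OF exp_at_bot])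
  then have "((\<lambda>t. M * exp (- \<rho> * t)) \<longlongrightarrow> 0) at_top"
    by (rule tendsto_mult_right_zero)
  then have "((\<lambda>t. B t - (\<chi> v. 1)) \<longlongrightarrow> 0) at_top"
    by (rule Lim_null_comparison[rotated])
      (use M in \<open>auto intro: eventually_mono[OF eventually_ge_at_top[of 0]]\<close>)
  then show ?thesis
    by (rule LIM_zero_cancel)
qed

text \<open>The witnessing neighborhood is not small: it consists of all states with positive
  coordinates.\<close>

lemma exp_stable_ones:
  fixes E :: "('v::finite \<times> 'v) set"
  assumes nbrs: "\<And>v. nbrs E v \<noteq> {}" and f: "type_III f"
  shows "exp_stable state_space (type_III_field E f) (\<chi> v. 1)"
  unfolding exp_stable_def
proof (rule exI, intro conjI allI impI)
  let ?P = "{b :: real ^ 'v. \<forall>v. b $ v > 0}"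
  have "open ?P"
    unfolding Collect_all_eq by (intro open_INT ballI open_Collect_less continuous_intros) auto
  then show "openin (top_of_set state_space) (state_space \<inter> ?P)"
    by (rule openin_open_Int)
  show "(\<chi> v. 1) \<in> state_space \<inter> ?P"
    by (simp add: state_space_def)
  fix B assume "trajectory state_space (type_III_field E f) B \<and> B 0 \<in> state_space \<inter> ?P"
  then have B: "trajectory state_space (type_III_field E f) B" "\<And>v. B 0 $ v > 0"
    by auto
  show "(B \<longlongrightarrow> (\<chi> v. 1)) at_top"
    by (rule trajectory_tendsto_one[OF nbrs f B])
  show "\<exists>\<rho>>0. \<exists>M>0. \<forall>t\<ge>0. norm (B t - (\<chi> v. 1)) \<le> M * exp (- \<rho> * t)"
    using trajectory_exp_convergence[OF nbrs f B] by metis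
qed

section \<open>Instability of the origin\<close>

text \<open>\<open>stable\<close> quantifies over all trajectories and could hold vacuously, so
  refuting it requires actual solutions starting near the origin.\<close>

lemma diagonal_trajectory_exists:
  fixes E :: "('v::finite \<times> 'v) set"
  assumes nbrs: "\<And>v. nbrs E v \<noteq> {}" and f: "type_III f" and a: "0 < a" "a < 1"
  obtains B where "trajectory state_space (type_III_field E f) B" "B 0 = (\<chi> v. a)"
proof -
  have cont: "continuous_on {0<..<1} (\<lambda>x. f x - x)"
    using f by (auto simp: type_III_def intro!: continuous_intros
        intro: continuous_on_subset[of "{0..1}"])
  have bounds: "0 < f y - y" "f y - y \<le> 1 - y" if "y \<in> {0<..<1}" for y
    using f that by (auto simp: type_III_def image_subset_iff)
  obtain x where x: "x 0 = a" "\<forall>t\<ge>0. x t \<in> {0<..<1}"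
    "\<forall>t\<ge>0. (x has_real_derivative f (x t) - x t) (at t)"
    by (rule global_scalar_solution[OF cont bounds a])
  define B where "B t = (\<chi> v::'v. x t)" for t
  \<comment> \<open>As a scalar function times a fixed vector, \<open>B\<close> inherits its
    derivative from \<open>x\<close>.\<close>
  have B_alt: "B t = x t *\<^sub>R (\<chi> v. 1)" for t
    by (simp add: B_def vec_eq_iff)
  show thesis
  proof
    show "B 0 = (\<chi> v. a)"
      by (simp add: B_def x)
    show "trajectory state_space (type_III_field E f) B"
      unfolding trajectory_def
    proof (intro allI impI conjI)
      fix t :: real assume "t \<ge> 0"
      show "B t \<in> state_space"
        using x(2) \<open>t \<ge> 0\<close> by (simp add: B_def state_space_def less_imp_le)
      have "(x has_real_derivative f (x t) - x t) (at t within {0..})"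
        using x(3) \<open>t \<ge> 0\<close> by (simp add: has_field_derivative_at_within)
      from has_vector_derivative_scaleR[OF this has_vector_derivative_const]
      have "((\<lambda>t. x t *\<^sub>R ((\<chi> v. 1) :: real ^ 'v)) has_vector_derivative
              (f (x t) - x t) *\<^sub>R ((\<chi> v. 1) :: real ^ 'v)) (at t within {0..})"
        by simp
      moreover have "(f (x t) - x t) *\<^sub>R (\<chi> v. 1) = type_III_field E f (B t)"
        by (simp add: B_def type_III_field_diagonal[OF nbrs] vec_eq_iff)
      ultimately show "(B has_vector_derivative type_III_field E f (B t)) (at t within {0..})"
        by (simp flip: B_alt)
    qed
  qed
qed

lemma unstable_zeros:
  fixes E :: "('v::finite \<times> 'v) set"
  assumes nbrs: "\<And>v. nbrs E v \<noteq> {}" and f: "type_III f"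
  shows "unstable state_space (type_III_field E f) (\<chi> v. 0)"
  unfolding unstable_def stable_def
proof (intro notI, elim exE conjE)
  fix U :: "(real ^ 'v) set"
  assume U: "openin (top_of_set state_space) U" "(\<chi> v. 0) \<in> U"
    and conv: "\<forall>B. trajectory state_space (type_III_field E f) B \<and> B 0 \<in> U \<longrightarrow>
                 (B \<longlongrightarrow> (\<chi> v. 0)) at_top"
  obtain T where T: "open T" "U = state_space \<inter> T"
    using U(1) by (auto simp: openin_open)
  \<comment> \<open>Constant vectors with small positive entries enter every neighborhood of the
    origin, and they are admissible synchronous starting points.\<close>
  have "((\<lambda>a. \<chi> v::'v. a) \<longlongrightarrow> (\<chi> v. 0)) (at_right (0 :: real))"
    by (intro tendsto_vec_lambda tendsto_ident_at)
  then have "\<forall>\<^sub>F a in at_right 0. (\<chi> v::'v. a) \<in> T"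
    using T U(2) by (auto dest: topological_tendstoD)
  moreover have "\<forall>\<^sub>F a in at_right 0. (a :: real) \<in> {0<..<1}"
    by (rule eventually_at_right_real) simp
  ultimately have "\<forall>\<^sub>F a in at_right 0. (\<chi> v::'v. a) \<in> T \<and> a \<in> {0<..<1}"
    by (rule eventually_conj)
  then obtain a where a: "(\<chi> v::'v. a) \<in> T" "0 < a" "a < 1"
    using eventually_happens'[OF trivial_limit_at_right_real] by fastforce
  obtain B where B: "trajectory state_space (type_III_field E f) B" "B 0 = (\<chi> v. a)"
    using diagonal_trajectory_exists[OF nbrs f a(2,3)] by blast
  have "B 0 \<in> U"
    using B a T by (simp add: state_space_def)
  then have "(B \<longlongrightarrow> (\<chi> v. 0)) at_top"
    using conv B by blast
  moreover have "(B \<longlongrightarrow> (\<chi> v. 1)) at_top"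
    by (rule trajectory_tendsto_one[OF nbrs f B(1)]) (use B a in simp)
  ultimately have "(\<chi> v. 0) = ((\<chi> v. 1) :: real ^ 'v)"
    by (rule tendsto_unique[OF trivial_limit_at_top_linorder])
  then show False
    by (simp add: vec_eq_iff)
qed

theorem theorem8:
  fixes E :: "('v::finite \<times> 'v) set" and f :: "real \<Rightarrow> real"
  assumes "irrefl E"
    and "\<forall>v. nbrs E v \<noteq> {}"
    and "type_III f"
  shows "(\<forall>B. trajectory state_space (type_III_field E f) B \<and> (\<forall>v. B 0 $ v > 0) \<longrightarrow>
            (\<forall>v. ((\<lambda>t. B t $ v) \<longlongrightarrow> 1) at_top)) \<and>
         (equilibrium state_space (type_III_field E f) (\<chi> v. 1) \<and>
          exp_stable state_space (type_III_field E f) (\<chi> v. 1)) \<and>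
         (equilibrium state_space (type_III_field E f) (\<chi> v. 0) \<and>
          unstable state_space (type_III_field E f) (\<chi> v. 0))"
proof -
  have nbrs: "\<And>v. nbrs E v \<noteq> {}" and f: "type_III f"
    using assms by auto
  have equil: "equilibrium state_space (type_III_field E f) (\<chi> v. x)" if "x \<in> {0, 1}" for x
    using that f
    by (auto simp: equilibrium_def type_III_field_diagonal[OF nbrs] type_III_def
        state_space_def vec_eq_iff)
  have "((\<lambda>t. B t $ v) \<longlongrightarrow> 1) at_top"
    if "trajectory state_space (type_III_field E f) B" "\<forall>v. B 0 $ v > 0" for B v
    using tendsto_vec_nth[OF trajectory_tendsto_one[OF nbrs f that(1)], of v] that(2) by simp
  then show ?thesis
    using equil[of 0] equil[of 1] exp_stable_ones[OF nbrs f] unstable_zeros[OF nbrs f] by simp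
qed

end
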